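(* Let $\kappa\in\{1,-1\}$. For every $n\in\mathbb N_0$ the coefficient $a_n(\kappa)$ of the formal solution $e^{\kappa P(z)}z^{-\tau(\kappa)}\sum_{n\ge0}a_n(\kappa)z^{-n}$ of $z^2f''+zf'-\big[\sum_{m=1}^6 D_mz^{-m}+L^2+\sum_{m=1}^6 B_mz^m\big]f=0$ is $$a_n(\kappa)=\sum_{(m,n_1,n_2)\in I_n}b(\kappa;m,n_1,n_2),\qquad I_n=\{(m,n_1,n_2)\in\mathbb N_0^3:\ 3m-2n_1-n_2=n\},$$ where for each $n$ only finitely many terms of the sum are nonzero.
   Context: Setting. $D_1,\dots,D_6,B_1,\dots,B_6,L$ are real, $B_6>0$, $L\ge0$. Put $p_3=\frac13\sqrt{B_6}$, $p_2=\frac{B_5}{12p_3}$, $p_1=\frac{B_4-4p_2^2}{6p_3}$, $s_0=p_3$, $t_{10}=p_2$, $t_{20}=p_1$, $P(z)=p_3z^3+p_2z^2+p_1z$, and for $\kappa\in\{1,-1\}$ $$\tau(\kappa)=\tfrac32-\tfrac16\frac{B_3}{\kappa p_3}+\tfrac23\frac{p_1p_2}{\kappa p_3}.$$ The coefficients $a_n=a_n(\kappa)$ are given by $a_0=1$, $a_n=0$ for $n<0$, and for $n\ge1$ $$\begin{aligned}6\kappa p_3na_n={}&[-4\kappa p_2(\tau(\kappa)+n-2)+p_1^2-B_2]a_{n-1}+[-2\kappa p_1(\tau(\kappa)+n-\tfrac52)-B_1]a_{n-2}\\&+(\tau(\kappa)+n-3-L)(\tau(\kappa)+n-3+L)a_{n-3}-\sum_{m=1}^6D_ma_{n-m-3}.\end{aligned}$$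 Coefficients $b$. For $\kappa\in\{1,-1\}$ the numbers $b(\kappa;m,n_1,n_2)$ are given by $$\begin{aligned}&6\kappa s_0(3m-2n_1-n_2)b(\kappa;m,n_1,n_2)=[(3m-2n_1-n_2+\tau(\kappa)-3)^2-L^2]\,b(\kappa;m-1,n_1,n_2)\\&+[-4\kappa t_{10}(3m-2n_1-n_2+\tau(\kappa)-2)+t_{20}^2-B_2]\,b(\kappa;m-1,n_1-1,n_2)\\&+[-2\kappa t_{20}(3m-2n_1-n_2+\tau(\kappa)-\tfrac52)-B_1]\,b(\kappa;m-1,n_1,n_2-1)\\&-D_1b(\kappa;m-2,n_1-1,n_2)-D_2b(\kappa;m-2,n_1,n_2-1)-D_3b(\kappa;m-2,n_1,n_2)\\&-D_4b(\kappa;m-3,n_1-1,n_2)-D_5b(\kappa;m-3,n_1,n_2-1)-D_6b(\kappa;m-3,n_1,n_2),\end{aligned}$$ with $b(\kappa;0,0,0)=1$; $b(\kappa;m,n_1,n_2)=0$ if $3m-2n_1-n_2=0$ and $(m,n_1,n_2)\ne(0,0,0)$; and $b=0$ if any index is negative. *)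

theory Defs
  imports Complex_Main "HOL-Computational_Algebra.Formal_Laurent_Series"
begin

text \<open>The coefficient families \<open>B\<close> and \<open>D\<close> are functions on the naturals of which only the values at
  1, ..., 6 are used; \<open>\<kappa>\<close> stands for 1 or -1.\<close>

definition p3 :: "(nat \<Rightarrow> real) \<Rightarrow> real" where
  "p3 B = 1/3 * sqrt (B 6)"

definition p2 :: "(nat \<Rightarrow> real) \<Rightarrow> real" where
  "p2 B = B 5 / (12 * p3 B)"

definition p1 :: "(nat \<Rightarrow> real) \<Rightarrow> real" where
  "p1 B = (B 4 - 4 * (p2 B)^2) / (6 * p3 B)"

definition s0 :: "(nat \<Rightarrow> real) \<Rightarrow> real" where
  "s0 B = p3 B"

definition t10 :: "(nat \<Rightarrow> real) \<Rightarrow> real" where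
  "t10 B = p2 B"

definition t20 :: "(nat \<Rightarrow> real) \<Rightarrow> real" where
  "t20 B = p1 B"

definition tau :: "(nat \<Rightarrow> real) \<Rightarrow> real \<Rightarrow> real" where
  "tau B \<kappa> = 3/2 - 1/6 * (B 3 / (\<kappa> * p3 B)) + 2/3 * (p1 B * p2 B / (\<kappa> * p3 B))"

function a_coeff :: "(nat \<Rightarrow> real) \<Rightarrow> (nat \<Rightarrow> real) \<Rightarrow> real \<Rightarrow> real \<Rightarrow> int \<Rightarrow> real" where
  "a_coeff B D L \<kappa> n =
    (if n < 0 then 0 else if n = 0 then 1 else
      ((- 4 * \<kappa> * p2 B * (tau B \<kappa> + of_int n - 2) + (p1 B)^2 - B 2) * a_coeff B D L \<kappa> (n - 1)
       + (- 2 * \<kappa> * p1 B * (tau B \<kappa> + of_int n - 5/2) - B 1) * a_coeff B D L \<kappa> (n - 2)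
       + (tau B \<kappa> + of_int n - 3 - L) * (tau B \<kappa> + of_int n - 3 + L) * a_coeff B D L \<kappa> (n - 3)
       - (\<Sum>m\<in>{1..6::nat}. D m * a_coeff B D L \<kappa> (n - int m - 3)))
      / (6 * \<kappa> * p3 B * of_int n))"
  by pat_completeness auto
termination
  by (relation "measure (\<lambda>(B, D, L, \<kappa>, n). nat (n + 1))") auto

declare a_coeff.simps [simp del]

function b_coeff :: "(nat \<Rightarrow> real) \<Rightarrow> (nat \<Rightarrow> real) \<Rightarrow> real \<Rightarrow> real \<Rightarrow> int \<Rightarrow> int \<Rightarrow> int \<Rightarrow> real" where
  "b_coeff B D L \<kappa> m n1 n2 =
    (if m < 0 \<or> n1 < 0 \<or> n2 < 0 then 0
     else if m = 0 \<and> n1 = 0 \<and> n2 = 0 then 1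
     else if 3 * m - 2 * n1 - n2 = 0 then 0
     else
      (((of_int (3 * m - 2 * n1 - n2) + tau B \<kappa> - 3)^2 - L^2) * b_coeff B D L \<kappa> (m - 1) n1 n2
       + (- 4 * \<kappa> * t10 B * (of_int (3 * m - 2 * n1 - n2) + tau B \<kappa> - 2) + (t20 B)^2 - B 2)
           * b_coeff B D L \<kappa> (m - 1) (n1 - 1) n2
       + (- 2 * \<kappa> * t20 B * (of_int (3 * m - 2 * n1 - n2) + tau B \<kappa> - 5/2) - B 1)
           * b_coeff B D L \<kappa> (m - 1) n1 (n2 - 1)
       - D 1 * b_coeff B D L \<kappa> (m - 2) (n1 - 1) n2
       - D 2 * b_coeff B D L \<kappa> (m - 2) n1 (n2 - 1)
       - D 3 * b_coeff B D L \<kappa> (m - 2) n1 n2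
       - D 4 * b_coeff B D L \<kappa> (m - 3) (n1 - 1) n2
       - D 5 * b_coeff B D L \<kappa> (m - 3) n1 (n2 - 1)
       - D 6 * b_coeff B D L \<kappa> (m - 3) n1 n2)
      / (6 * \<kappa> * s0 B * of_int (3 * m - 2 * n1 - n2)))"
  by pat_completeness auto
termination
  by (relation "measure (\<lambda>(B, D, L, \<kappa>, m, n1, n2). nat (m + 1))") auto

declare b_coeff.simps [simp del]

definition I_set :: "nat \<Rightarrow> (nat \<times> nat \<times> nat) set" where
  "I_set n = {(m, n1, n2). 3 * int m - 2 * int n1 - int n2 = int n}"

text \<open>Formal solutions. Formal series in descending powers of \<open>z\<close> are formal Laurent series in
  \<open>w = 1/z\<close>: \<open>fls_X\<close> represents \<open>1/z\<close>, \<open>fls_X_inv\<close> represents \<open>z\<close>, and \<open>d/dz = - w\<^sup>2 d/dw\<close>.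
  A formal expression \<open>exp(E) z\<^sup>\<rho> S\<close> is represented by the triple \<open>E\<close>, \<open>\<rho>\<close>, \<open>S\<close>. Its \<open>z\<close>-derivative
  is \<open>exp(E) z\<^sup>\<rho> (E' S + \<rho> z\<^sup>-\<^sup>1 S + S')\<close>, so differentiation acts on the factor \<open>S\<close> alone, and
  the differential equation holds formally iff it holds after cancelling \<open>exp(E) z\<^sup>\<rho>\<close>.\<close>

definition dz :: "real fls \<Rightarrow> real fls" where
  "dz S = - (fls_X^2) * fls_deriv S"

definition dz_twisted :: "real fls \<Rightarrow> real \<Rightarrow> real fls \<Rightarrow> real fls" where
  "dz_twisted E \<rho> S = dz E * S + fls_const \<rho> * fls_X * S + dz S"

definition is_formal_solution ::
  "(nat \<Rightarrow> real) \<Rightarrow> (nat \<Rightarrow> real) \<Rightarrow> real \<Rightarrow> real fls \<Rightarrow> real \<Rightarrow> real fls \<Rightarrow> bool" where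
  "is_formal_solution B D L E \<rho> S \<longleftrightarrow>
     fls_X_inv^2 * dz_twisted E \<rho> (dz_twisted E \<rho> S) + fls_X_inv * dz_twisted E \<rho> S
     - ((\<Sum>m\<in>{1..6::nat}. fls_const (D m) * fls_X^m) + fls_const (L^2)
        + (\<Sum>m\<in>{1..6::nat}. fls_const (B m) * fls_X_inv^m)) * S = 0"

definition P_fls :: "(nat \<Rightarrow> real) \<Rightarrow> real fls" where
  "P_fls B = fls_const (p3 B) * fls_X_inv^3 + fls_const (p2 B) * fls_X_inv^2
             + fls_const (p1 B) * fls_X_inv"

definition series_in_inverse_z :: "(nat \<Rightarrow> real) \<Rightarrow> real fls" where
  "series_in_inverse_z c = fps_to_fls (Abs_fps c)"

end

theory Submission
  imports Defs
begin

text \<open>With \<open>\<theta> = z d/dz\<close> and \<open>Q = z P'\<close> the equation becomes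
  \<open>(\<kappa> Q + \<theta> - \<tau>)\<^sup>2 S = (\<Sum>m. D\<^sub>m z\<^sup>-\<^sup>m + L\<^sup>2 + \<Sum>m. B\<^sub>m z\<^sup>m) S\<close>. The choice of
  \<open>p\<^sub>3, p\<^sub>2, p\<^sub>1\<close> cancels \<open>z\<^sup>6, z\<^sup>5, z\<^sup>4\<close>, that of \<open>\<tau>\<close> cancels the part of the \<open>z\<^sup>3\<close> terms
  independent of \<open>n\<close>, and what remains is the recurrence of \<open>a\<close>.
  Each term \<open>b(m - d, n\<^sub>1 - e, n\<^sub>2 - f)\<close> of the other recurrence has weight
  \<open>3m - 2n\<^sub>1 - n\<^sub>2\<close> lowered by \<open>3d - 2e - f \<ge> d\<close>. Hence \<open>b\<close> is supported where the weight is at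
  least \<open>m\<close>, and summing its recurrence over all indices of weight \<open>n\<close> gives the recurrence of
  \<open>a\<close>.\<close>

unbundle fps_syntax

section \<open>Recurrence and series of the coefficients \<open>a\<close>\<close>

lemma a_coeff_neg: "n < 0 \<Longrightarrow> a_coeff B D L \<kappa> n = 0"
  by (simp add: a_coeff.simps)

lemma sum_one_to_six: "(\<Sum>m\<in>{1..6::nat}. f m) = f 1 + f 2 + f 3 + f 4 + f 5 + (f 6 :: 'a::comm_monoid_add)"
by (simp add: eval_nat_numeral add.assoc)

text \<open>For \<open>n < 0\<close> every coefficient is 0, and at \<open>n = 0\<close> the left
  factor \<open>n\<close> vanishes while the right side has only negative indices. So no sign
  condition is needed, and coefficients can be compared at every integer exponent.\<close>

lemma a_coeff_rec:
  assumes "B 6 > 0" "\<kappa> \<noteq> 0"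
  shows "6 * \<kappa> * p3 B * of_int n * a_coeff B D L \<kappa> n =
      (- 4 * \<kappa> * p2 B * (tau B \<kappa> + of_int n - 2) + (p1 B)^2 - B 2) * a_coeff B D L \<kappa> (n - 1)
       + (- 2 * \<kappa> * p1 B * (tau B \<kappa> + of_int n - 5/2) - B 1) * a_coeff B D L \<kappa> (n - 2)
       + (tau B \<kappa> + of_int n - 3 - L) * (tau B \<kappa> + of_int n - 3 + L) * a_coeff B D L \<kappa> (n - 3)
       - (\<Sum>m\<in>{1..6::nat}. D m * a_coeff B D L \<kappa> (n - int m - 3))"
proof (cases "n \<le> 0")
  case True
  then show ?thesis by (cases "n = 0") (simp_all add: a_coeff_neg)
next
  case False
  have "p3 B \<noteq> 0" using assms by (simp add: p3_def)
  with False assms show ?thesis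
    by (subst a_coeff.simps) simp
qed

lemma series_a_coeff_nth:
  "series_in_inverse_z (\<lambda>n. a_coeff B D L \<kappa> (int n)) $$ k = a_coeff B D L \<kappa> k"
  by (simp add: series_in_inverse_z_def a_coeff_neg)

section \<open>Coefficient extraction in \<open>w = 1/z\<close>: index \<open>k\<close> belongs to
  \<open>z^-k\<close>\<close>

lemma fls_X_mult_nth: "(fls_X * f) $$ k = f $$ (k - 1)" for f :: "'a::comm_ring_1 fls"
  by (simp add: fls_X_times_conv_shift)

lemma fls_X_inv_mult_nth: "(fls_X_inv * f) $$ k = f $$ (k + 1)" for f :: "'a::comm_ring_1 fls"
  by (simp add: fls_X_inv_times_conv_shift)

lemma fls_X_power_mult_nth: "(fls_X ^ n * f) $$ k = f $$ (k - int n)" for f :: "'a::comm_ring_1 fls"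
  by (simp add: fls_X_power_times_conv_shift)

lemma fls_X_inv_power_mult_nth: "(fls_X_inv ^ n * f) $$ k = f $$ (k + int n)" for f :: "'a::comm_ring_1 fls"
  by (simp add: fls_X_inv_power_times_conv_shift)

text \<open>The derivative of \<open>z^-(k-1)\<close> is \<open>-(k-1) z^-k\<close>.\<close>

lemma dz_nth: "dz S $$ k = - (of_int k - 1) * S $$ (k - 1)"
  by (simp add: dz_def fls_X_power_mult_nth) (simp add: algebra_simps)

lemma dz_exponent:
  "dz (fls_const \<kappa> * P_fls B) =
     fls_const (3 * \<kappa> * p3 B) * fls_X_inv^2 + fls_const (2 * \<kappa> * p2 B) * fls_X_inv
     + fls_const (\<kappa> * p1 B)"
proof (rule fls_eqI)
  fix k
  show "dz (fls_const \<kappa> * P_fls B) $$ k = (fls_const (3 * \<kappa> * p3 B) * fls_X_inv^2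
          + fls_const (2 * \<kappa> * p2 B) * fls_X_inv + fls_const (\<kappa> * p1 B)) $$ k"
    by (auto simp: dz_nth P_fls_def fls_X_inv_power_nth algebra_simps)
qed

text \<open>A factor \<open>z^j\<close> in \<open>\<kappa> P'\<close> reads the index
  \<open>k + j\<close>; the term at \<open>k - 1\<close> collects both \<open>\<rho> S / z\<close>
  and \<open>S'\<close>.\<close>

lemma dz_twisted_nth:
  "dz_twisted (fls_const \<kappa> * P_fls B) \<rho> S $$ k =
     3 * \<kappa> * p3 B * S $$ (k + 2) + 2 * \<kappa> * p2 B * S $$ (k + 1) + \<kappa> * p1 B * S $$ k
     + (\<rho> - of_int k + 1) * S $$ (k - 1)"
  unfolding dz_twisted_def dz_exponent
  by (simp add: dz_nth distrib_right mult.assoc fls_X_mult_nth fls_X_inv_mult_nth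
      fls_X_inv_power_mult_nth del: fls_const_mult_const) (simp add: algebra_simps)

section \<open>The formal solution\<close>

lemma is_formal_solution_a_coeff:
  assumes "B 6 > 0" and "\<kappa> \<in> {1, -1}"
  shows "is_formal_solution B D L (fls_const \<kappa> * P_fls B) (- tau B \<kappa>)
           (series_in_inverse_z (\<lambda>n. a_coeff B D L \<kappa> (int n)))"
  unfolding is_formal_solution_def
proof (rule fls_eqI, goal_cases)
  case (1 k)
  define a where "a = a_coeff B D L \<kappa>"
  have \<kappa>: "\<kappa> * \<kappa> = 1" "\<kappa> \<noteq> 0" using assms(2) by auto
  have kappa_cancel: "\<kappa> * (\<kappa> * x) = x" for x
    using \<kappa>(1) by (simp flip: mult.assoc)
  have p3: "p3 B \<noteq> 0" using assms(1) by (simp add: p3_def)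
  \<comment> \<open>The definitions of \<open>p3\<close>, \<open>p2\<close>, \<open>p1\<close>,
    \<open>tau\<close> are solved for \<open>B 6\<close>, ..., \<open>B 3\<close>. Substituted into
    the coefficient of \<open>z^-k\<close>, they cancel the terms in \<open>a (k+6)\<close>,
    \<open>a (k+5)\<close>, \<open>a (k+4)\<close> and reduce the next one to
    \<open>-6 \<kappa> p3 (k+3) a (k+3)\<close>.\<close>
  have B6: "B 6 = 9 * p3 B * p3 B" using assms(1) by (simp add: p3_def)
  have B5: "B 5 = 12 * p2 B * p3 B" using p3 by (simp add: p2_def)
  have B4: "B 4 = 6 * p1 B * p3 B + 4 * p2 B * p2 B"
  proof -
    have "p1 B * (6 * p3 B) = B 4 - 4 * (p2 B)^2" using p3 by (simp add: p1_def)
    then show ?thesis by (simp add: power2_eq_square)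
  qed
  have "\<kappa> * p3 B * tau B \<kappa> = 3/2 * \<kappa> * p3 B - B 3 / 6 + 2/3 * p1 B * p2 B"
    using p3 \<kappa>(2) unfolding tau_def by (simp add: field_simps)
  then have B3: "B 3 = 9 * \<kappa> * p3 B + 4 * p1 B * p2 B - 6 * \<kappa> * p3 B * tau B \<kappa>"
    by (simp add: algebra_simps)
  \<comment> \<open>The recurrence is taken at \<open>n = k + 3\<close>, the highest index that
    survives.\<close>
  have rec: "6 * \<kappa> * p3 B * of_int (k+3) * a (k+3) =
      (- 4 * \<kappa> * p2 B * (tau B \<kappa> + of_int k + 1) + p1 B * p1 B - B 2) * a (k+2)
       + (- 2 * \<kappa> * p1 B * (tau B \<kappa> + of_int k + 1/2) - B 1) * a (k+1)
       + (tau B \<kappa> + of_int k - L) * (tau B \<kappa> + of_int k + L) * a k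
       - (D 1 * a (k-1) + D 2 * a (k-2) + D 3 * a (k-3) + D 4 * a (k-4) + D 5 * a (k-5)
          + D 6 * a (k-6))"
    using a_coeff_rec[of B \<kappa> "k+3" D L] assms(1) \<kappa>(2)
    unfolding sum_one_to_six
    by (simp add: a_def power2_eq_square algebra_simps)
  define S where "S = series_in_inverse_z (\<lambda>n. a_coeff B D L \<kappa> (int n))"
  have S: "S $$ j = a j" for j by (simp add: S_def a_def series_a_coeff_nth)
  show ?case
    using rec unfolding sum_one_to_six S_def[symmetric]
    by (simp add: dz_twisted_nth distrib_right mult.assoc fls_X_mult_nth fls_X_inv_mult_nth
        fls_X_power_mult_nth fls_X_inv_power_mult_nth del: One_nat_def)
      (simp add: S B3 B4 B5 B6 kappa_cancel power2_eq_square algebra_simps del: One_nat_def)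
qed

section \<open>Support of \<open>b\<close>\<close>

lemma b_coeff_support:
  "b_coeff B D L \<kappa> m n1 n2 \<noteq> 0 \<Longrightarrow> 0 \<le> n1 \<and> 0 \<le> n2 \<and> 0 \<le> m \<and> m \<le> 3 * m - 2 * n1 - n2"
proof (induction B D L \<kappa> m n1 n2 rule: b_coeff.induct)
  case (1 B D L \<kappa> m n1 n2)
  show ?case
  proof (cases "m < 0 \<or> n1 < 0 \<or> n2 < 0 \<or> m = 0 \<and> n1 = 0 \<and> n2 = 0 \<or> 3 * m - 2 * n1 - n2 = 0")
    case True
    then show ?thesis
      using "1.prems" by (subst (asm) b_coeff.simps) (auto split: if_splits)
  next
    case False
    let ?b = "b_coeff B D L \<kappa>"
    \<comment> \<open>A nonzero value needs a nonzero predecessor. Passing to it lowers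
      \<open>m\<close> by \<open>d\<close> and the weight by at least \<open>d\<close>, so its bound
      carries over.\<close>
    have "?b (m-1) n1 n2 \<noteq> 0 \<or> ?b (m-1) (n1-1) n2 \<noteq> 0 \<or> ?b (m-1) n1 (n2-1) \<noteq> 0
      \<or> ?b (m-2) (n1-1) n2 \<noteq> 0 \<or> ?b (m-2) n1 (n2-1) \<noteq> 0 \<or> ?b (m-2) n1 n2 \<noteq> 0
      \<or> ?b (m-3) (n1-1) n2 \<noteq> 0 \<or> ?b (m-3) n1 (n2-1) \<noteq> 0 \<or> ?b (m-3) n1 n2 \<noteq> 0"
    proof (rule ccontr)
      assume "\<not> ?thesis"
      then have "?b m n1 n2 = 0"
        using False by (subst b_coeff.simps) simp
      then show False using "1.prems" by simp
    qed
    moreover have "\<not> (m < 0 \<or> n1 < 0 \<or> n2 < 0)" "\<not> (m = 0 \<and> n1 = 0 \<and> n2 = 0)"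
      "3 * m - 2 * n1 - n2 \<noteq> 0" using False by auto
    note IH = "1.IH"[OF this]
    ultimately show ?thesis
      by (elim disjE; use IH in force)
  qed
qed

section \<open>Sums of \<open>b\<close> over a fixed weight\<close>

text \<open>Integer triples keep the shifts of the recurrence exact. The bound
  \<open>m \<le> n\<close> makes the set finite and, by \<open>b_coeff_support\<close>, discards
  only zero terms.\<close>

definition index_set :: "int \<Rightarrow> (int \<times> int \<times> int) set" where
  "index_set n = {(m, n1, n2). 3 * m - 2 * n1 - n2 = n \<and> 0 \<le> m \<and> m \<le> n \<and> 0 \<le> n1 \<and> 0 \<le> n2}"

lemma finite_index_set: "finite (index_set n)"
  \<comment> \<open>The box comes from \<open>2 * n1 + n2 = 3 * m - n \<le> 2 * n\<close>.\<close>
  by (rule finite_subset[of _ "{0..n} \<times> {0..2*n} \<times> {0..2*n}"]) (auto simp: index_set_def)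

definition b_sum :: "(nat \<Rightarrow> real) \<Rightarrow> (nat \<Rightarrow> real) \<Rightarrow> real \<Rightarrow> real \<Rightarrow> int \<Rightarrow> real" where
  "b_sum B D L \<kappa> n = (\<Sum>(m, n1, n2)\<in>index_set n. b_coeff B D L \<kappa> m n1 n2)"

text \<open>Translation by \<open>(d, e, f)\<close> maps \<open>index_set (n - k)\<close> into
  \<open>index_set n\<close> because \<open>d \<le> k\<close>; off its image the shifted coefficient
  vanishes by \<open>b_coeff_support\<close>.\<close>

lemma b_sum_shift:
  assumes "k = 3 * d - 2 * e - f" "0 \<le> d" "0 \<le> e" "0 \<le> f" "d \<le> k"
  shows "(\<Sum>(m, n1, n2)\<in>index_set n. b_coeff B D L \<kappa> (m - d) (n1 - e) (n2 - f)) = b_sum B D L \<kappa> (n - k)"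
proof -
  let ?s = "\<lambda>(m, n1, n2). (m + d, n1 + e, n2 + f)"
  let ?g = "\<lambda>(m, n1, n2). b_coeff B D L \<kappa> (m - d) (n1 - e) (n2 - f)"
  have inj: "inj_on ?s (index_set (n - k))" by (auto simp: inj_on_def)
  have "sum ?g (index_set n) = sum ?g (?s ` index_set (n - k))"
  proof (rule sum.mono_neutral_right[OF finite_index_set])
    show "?s ` index_set (n - k) \<subseteq> index_set n" using assms by (auto simp: index_set_def)
    show "\<forall>p\<in>index_set n - ?s ` index_set (n - k). ?g p = 0"
    proof (intro ballI, rule ccontr)
      fix p assume p: "p \<in> index_set n - ?s ` index_set (n - k)" and nz: "?g p \<noteq> 0"
      obtain m n1 n2 where [simp]: "p = (m, n1, n2)" by (cases p)
      have "(m - d, n1 - e, n2 - f) \<in> index_set (n - k)"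
        using b_coeff_support[of B D L \<kappa> "m - d" "n1 - e" "n2 - f"] nz p assms
        by (auto simp: index_set_def)
      then have "p \<in> ?s ` index_set (n - k)" by (force intro: rev_image_eqI)
      with p show False by simp
    qed
  qed
  also have "\<dots> = b_sum B D L \<kappa> (n - k)"
    unfolding b_sum_def by (subst sum.reindex[OF inj]) (auto intro!: sum.cong)
  finally show ?thesis .
qed

text \<open>Positive weight excludes the origin and the zero-weight case, so the last branch of the
  definition applies.\<close>

lemma b_coeff_rec:
  assumes "B 6 > 0" "\<kappa> \<noteq> 0" "0 < n" "(m, n1, n2) \<in> index_set n"
  shows "6 * \<kappa> * p3 B * of_int n * b_coeff B D L \<kappa> m n1 n2 =
       ((of_int n + tau B \<kappa> - 3)^2 - L^2) * b_coeff B D L \<kappa> (m - 1) n1 n2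
       + (- 4 * \<kappa> * t10 B * (of_int n + tau B \<kappa> - 2) + (t20 B)^2 - B 2)
           * b_coeff B D L \<kappa> (m - 1) (n1 - 1) n2
       + (- 2 * \<kappa> * t20 B * (of_int n + tau B \<kappa> - 5/2) - B 1)
           * b_coeff B D L \<kappa> (m - 1) n1 (n2 - 1)
       - D 1 * b_coeff B D L \<kappa> (m - 2) (n1 - 1) n2
       - D 2 * b_coeff B D L \<kappa> (m - 2) n1 (n2 - 1)
       - D 3 * b_coeff B D L \<kappa> (m - 2) n1 n2
       - D 4 * b_coeff B D L \<kappa> (m - 3) (n1 - 1) n2
       - D 5 * b_coeff B D L \<kappa> (m - 3) n1 (n2 - 1)
       - D 6 * b_coeff B D L \<kappa> (m - 3) n1 n2"
proof -
  have *: "3 * m - 2 * n1 - n2 = n" "\<not> (m < 0 \<or> n1 < 0 \<or> n2 < 0)"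
    "\<not> (m = 0 \<and> n1 = 0 \<and> n2 = 0)" using assms by (auto simp: index_set_def)
  have "p3 B \<noteq> 0" using assms by (simp add: p3_def)
  then show ?thesis
    using * assms(2,3) by (subst b_coeff.simps) (simp only: * s0_def, simp)
qed

lemma b_sum_rec:
  assumes "B 6 > 0" "\<kappa> \<noteq> 0" "0 < n"
  shows "6 * \<kappa> * p3 B * of_int n * b_sum B D L \<kappa> n =
      (- 4 * \<kappa> * p2 B * (tau B \<kappa> + of_int n - 2) + (p1 B)^2 - B 2) * b_sum B D L \<kappa> (n - 1)
       + (- 2 * \<kappa> * p1 B * (tau B \<kappa> + of_int n - 5/2) - B 1) * b_sum B D L \<kappa> (n - 2)
       + (tau B \<kappa> + of_int n - 3 - L) * (tau B \<kappa> + of_int n - 3 + L) * b_sum B D L \<kappa> (n - 3)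
       - (\<Sum>m\<in>{1..6::nat}. D m * b_sum B D L \<kappa> (n - int m - 3))"
proof -
  let ?S = "\<lambda>d e f. \<Sum>(m, n1, n2)\<in>index_set n. b_coeff B D L \<kappa> (m - d) (n1 - e) (n2 - f)"
  have "6 * \<kappa> * p3 B * of_int n * b_sum B D L \<kappa> n =
    (\<Sum>(m, n1, n2)\<in>index_set n. 6 * \<kappa> * p3 B * of_int n * b_coeff B D L \<kappa> m n1 n2)"
    by (simp add: b_sum_def sum_distrib_left case_prod_unfold)
  \<comment> \<open>The subtracted zeros give all nine terms the shape required by
    \<open>b_sum_shift\<close>.\<close>
  also have "\<dots> = (\<Sum>(m, n1, n2)\<in>index_set n.
       ((of_int n + tau B \<kappa> - 3)^2 - L^2) * b_coeff B D L \<kappa> (m - 1) (n1 - 0) (n2 - 0)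
       + (- 4 * \<kappa> * t10 B * (of_int n + tau B \<kappa> - 2) + (t20 B)^2 - B 2)
           * b_coeff B D L \<kappa> (m - 1) (n1 - 1) (n2 - 0)
       + (- 2 * \<kappa> * t20 B * (of_int n + tau B \<kappa> - 5/2) - B 1)
           * b_coeff B D L \<kappa> (m - 1) (n1 - 0) (n2 - 1)
       - D 1 * b_coeff B D L \<kappa> (m - 2) (n1 - 1) (n2 - 0)
       - D 2 * b_coeff B D L \<kappa> (m - 2) (n1 - 0) (n2 - 1)
       - D 3 * b_coeff B D L \<kappa> (m - 2) (n1 - 0) (n2 - 0)
       - D 4 * b_coeff B D L \<kappa> (m - 3) (n1 - 1) (n2 - 0)
       - D 5 * b_coeff B D L \<kappa> (m - 3) (n1 - 0) (n2 - 1)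
       - D 6 * b_coeff B D L \<kappa> (m - 3) (n1 - 0) (n2 - 0))"
    unfolding diff_0_right
    by (rule sum.cong[OF refl]) (clarify, rule b_coeff_rec[where B=B, OF assms])
  also have "\<dots> = ((of_int n + tau B \<kappa> - 3)^2 - L^2) * ?S 1 0 0
       + (- 4 * \<kappa> * t10 B * (of_int n + tau B \<kappa> - 2) + (t20 B)^2 - B 2) * ?S 1 1 0
       + (- 2 * \<kappa> * t20 B * (of_int n + tau B \<kappa> - 5/2) - B 1) * ?S 1 0 1
       - D 1 * ?S 2 1 0 - D 2 * ?S 2 0 1 - D 3 * ?S 2 0 0
       - D 4 * ?S 3 1 0 - D 5 * ?S 3 0 1 - D 6 * ?S 3 0 0"
    by (simp only: case_prod_unfold sum.distrib sum_subtractf sum_distrib_left)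
  \<comment> \<open>The nine shifts lower the weight by 1, ..., 9, each once; \<open>D 1\<close>,
    ..., \<open>D 6\<close> belong to 4, ..., 9.\<close>
  also have "\<dots> = ((of_int n + tau B \<kappa> - 3)^2 - L^2) * b_sum B D L \<kappa> (n - 3)
       + (- 4 * \<kappa> * t10 B * (of_int n + tau B \<kappa> - 2) + (t20 B)^2 - B 2) * b_sum B D L \<kappa> (n - 1)
       + (- 2 * \<kappa> * t20 B * (of_int n + tau B \<kappa> - 5/2) - B 1) * b_sum B D L \<kappa> (n - 2)
       - D 1 * b_sum B D L \<kappa> (n - 4) - D 2 * b_sum B D L \<kappa> (n - 5) - D 3 * b_sum B D L \<kappa> (n - 6)
       - D 4 * b_sum B D L \<kappa> (n - 7) - D 5 * b_sum B D L \<kappa> (n - 8) - D 6 * b_sum B D L \<kappa> (n - 9)"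
    using b_sum_shift[of 3 1 0 0] b_sum_shift[of 1 1 1 0] b_sum_shift[of 2 1 0 1]
      b_sum_shift[of 4 2 1 0] b_sum_shift[of 5 2 0 1] b_sum_shift[of 6 2 0 0]
      b_sum_shift[of 7 3 1 0] b_sum_shift[of 8 3 0 1] b_sum_shift[of 9 3 0 0]
    by simp
  finally show ?thesis
    unfolding sum_one_to_six
    by (simp add: t10_def t20_def algebra_simps power2_eq_square)
qed

lemma b_sum_neg: "n < 0 \<Longrightarrow> b_sum B D L \<kappa> n = 0"
proof -
  assume "n < 0"
  then have "index_set n = {}" by (auto simp: index_set_def)
  then show ?thesis by (simp add: b_sum_def)
qed

lemma b_sum_0: "b_sum B D L \<kappa> 0 = 1"
proof -
  have "index_set 0 = {(0, 0, 0)}" by (auto simp: index_set_def)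
  then show ?thesis by (simp add: b_sum_def b_coeff.simps)
qed

text \<open>Both sequences vanish below 0, equal 1 at 0 and obey the same recurrence, whose leading
  factor \<open>6 \<kappa> p3 n\<close> is nonzero for \<open>n > 0\<close>.\<close>

lemma a_coeff_eq_b_sum:
  assumes "B 6 > 0" "\<kappa> \<noteq> 0"
  shows "a_coeff B D L \<kappa> n = b_sum B D L \<kappa> n"
proof (induction "nat n" arbitrary: n rule: less_induct)
  case less
  show ?case
  proof (cases "n \<le> 0")
    case True
    then show ?thesis by (cases "n = 0") (simp_all add: a_coeff_neg b_sum_neg b_sum_0 a_coeff.simps)
  next
    case False
    \<comment> \<open>As \<open>n > 0\<close>, \<open>nat (n - k) < nat n\<close> holds even when
      \<open>n - k\<close> is negative.\<close>
    then have "a_coeff B D L \<kappa> (n - k) = b_sum B D L \<kappa> (n - k)" if "0 < k" for k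
      using less that by simp
    then have "6 * \<kappa> * p3 B * of_int n * a_coeff B D L \<kappa> n
        = 6 * \<kappa> * p3 B * of_int n * b_sum B D L \<kappa> n"
      using False unfolding a_coeff_rec[where B=B, OF assms] sum_one_to_six
      by (simp add: b_sum_rec[where B=B, OF assms] sum_one_to_six del: One_nat_def)
    moreover have "p3 B \<noteq> 0" using assms by (simp add: p3_def)
    ultimately show ?thesis using assms False by simp
  qed
qed

section \<open>Passage from integer to natural indices\<close>

theorem mainTheorem6:
  fixes B D :: "nat \<Rightarrow> real" and L \<kappa> :: real
  assumes "B 6 > 0" and "L \<ge> 0" and "\<kappa> \<in> {1, -1}"
  shows "is_formal_solution B D L (fls_const \<kappa> * P_fls B) (- tau B \<kappa>)
           (series_in_inverse_z (\<lambda>n. a_coeff B D L \<kappa> (int n))) \<and>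
         (\<forall>n::nat.
           finite {(m, n1, n2). (m, n1, n2) \<in> I_set n \<and>
                     b_coeff B D L \<kappa> (int m) (int n1) (int n2) \<noteq> 0} \<and>
           a_coeff B D L \<kappa> (int n) =
             (\<Sum>(m, n1, n2) \<in> {(m, n1, n2). (m, n1, n2) \<in> I_set n \<and>
                     b_coeff B D L \<kappa> (int m) (int n1) (int n2) \<noteq> 0}.
                b_coeff B D L \<kappa> (int m) (int n1) (int n2)))"
proof (intro conjI allI)
  show "is_formal_solution B D L (fls_const \<kappa> * P_fls B) (- tau B \<kappa>)
           (series_in_inverse_z (\<lambda>n. a_coeff B D L \<kappa> (int n)))"
    using assms by (intro is_formal_solution_a_coeff)
next
  fix n :: nat
  let ?J = "{(m, n1, n2). (m, n1, n2) \<in> I_set n \<and> b_coeff B D L \<kappa> (int m) (int n1) (int n2) \<noteq> 0}"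
  let ?s = "\<lambda>(m, n1, n2). (int m, int n1, int n2)"
  let ?b = "\<lambda>(m, n1, n2). b_coeff B D L \<kappa> m n1 n2"
  have inj: "inj_on ?s ?J" by (auto simp: inj_on_def)
  have sub: "?s ` ?J \<subseteq> index_set (int n)"
    using b_coeff_support[of B D L \<kappa>] by (fastforce simp: index_set_def I_set_def)
  show "finite ?J"
    by (rule finite_imageD[OF finite_subset[OF sub finite_index_set] inj])
  have "a_coeff B D L \<kappa> (int n) = sum ?b (index_set (int n))"
    using a_coeff_eq_b_sum[of B \<kappa>] assms by (auto simp: b_sum_def)
  also have "\<dots> = sum ?b (?s ` ?J)"
  \<comment> \<open>Coordinates in \<open>index_set\<close> are nonnegative, so \<open>nat\<close>
    inverts the embedding \<open>?s\<close> and only zero terms lie outside the image.\<close>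
  proof (rule sum.mono_neutral_right[OF finite_index_set sub], intro ballI, rule ccontr)
    fix p assume p: "p \<in> index_set (int n) - ?s ` ?J" and nz: "?b p \<noteq> 0"
    obtain m n1 n2 where [simp]: "p = (m, n1, n2)" by (cases p)
    have "(nat m, nat n1, nat n2) \<in> ?J" "p = ?s (nat m, nat n1, nat n2)"
      using p nz by (auto simp: index_set_def I_set_def)
    then have "p \<in> ?s ` ?J" by blast
    with p show False by simp
  qed
  also have "\<dots> = (\<Sum>(m, n1, n2) \<in> ?J. b_coeff B D L \<kappa> (int m) (int n1) (int n2))"
    by (subst sum.reindex[OF inj]) (simp add: case_prod_unfold)
  finally show "a_coeff B D L \<kappa> (int n) =
      (\<Sum>(m, n1, n2) \<in> ?J. b_coeff B D L \<kappa> (int m) (int n1) (int n2))" .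
qed

end
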